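(* Consider the distributed index coding problem with $n$ messages, side information sets $A_j\subseteq[n]\setminus\{j\}$, $j\in[n]$, and given link capacities $\mathbf{C}=(C_J)_{J\in N}$, $C_J\ge0$, where $N$ is the set of nonempty subsets of $[n]$. Let $\mathbf{R}=(R_1,\dots,R_n)$ be a tuple of nonnegative reals. Suppose there exist nonnegative reals $C_{K,J}$ (composite rates), for $J\in N$ and $\emptyset\neq K\subseteq J$, such that $$\sum_{\emptyset\neq K\subseteq J:\, K\not\subseteq A_j} C_{K,J}\le C_J\qquad\text{for all } j\in[n],\ J\in N,$$ and such that for every $j\in[n]$ there exists a decoding set $D_j\subseteq[n]$ with $j\in D_j$ satisfying $$\sum_{i\in L} R_i < \sum_{K\subseteq D_j\cup A_j:\, K\cap L\neq\emptyset}\ \ \sum_{J\in N:\, K\subseteq J} C_{K,J}\qquad\text{for all nonempty } L\subseteq D_j\setminus A_j .$$ Then $\mathbf{R}$ belongs to the capacity region of the problem for the given $\mathbf{C}$.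
   Context: Distributed index coding. $[n]=\{1,\dots,n\}$ and $N=\{J\subseteq[n] : J\neq\emptyset\}$. There are $n$ messages $x_j\in\{0,1\}^{t_j}$, $j\in[n]$ ($t_j$ nonnegative integers), and $n$ receivers; receiver $j$ wants $x_j$ and knows a priori the messages $x(A_j)=(x_i)_{i\in A_j}$, where $A_j\subseteq[n]\setminus\{j\}$. For each $J\in N$ there is a server holding exactly the messages $x_i$, $i\in J$; it broadcasts noiselessly to all receivers a sequence $y_J\in\{0,1\}^{u_J}$ ($u_J$ a nonnegative integer) that is a function of $(x_i)_{i\in J}$. Receiver $j$ must recover $x_j$ exactly as a function of $(y_J)_{J\in N}$ and $x(A_j)$, for every realization of the messages. A code consists of such lengths, encoding functions and decoding functions. With link capacities $C_J\ge 0$, the tuple $(\mathbf{R},\mathbf{C})$ is achievable if there exist such a code and some $r>0$ with $R_j\le t_j/r$ for all $j\in[n]$ and $C_J\ge u_J/r$ for all $J\in N$. For given $\mathbf{C}$, the capacity region is the closure of the set of (nonnegative) rate tuples $\mathbf{R}$ such that $(\mathbf{R},\mathbf{C})$ is achievable. *)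

theory Defs
  imports "HOL-Analysis.Analysis" "HOL-Library.FuncSet"
begin

text \<open>
  The messages and the receivers are both indexed by a finite type \<open>'n\<close> playing the role
  of $[n]$, and rate tuples are vectors in \<open>real ^ 'n\<close>. Servers and link capacities are
  indexed by \<open>'n set\<close>; a value at the empty set is never used.
\<close>

definition servers :: "'n::finite set set" where
  "servers = {J. J \<noteq> {}}"

definition messages :: "('n::finite \<Rightarrow> nat) \<Rightarrow> ('n \<Rightarrow> bool list) set" where
  "messages t = {x. \<forall>j. length (x j) = t j}"

definition broadcast ::
  "('n::finite set \<Rightarrow> ('n \<Rightarrow> bool list) \<Rightarrow> bool list) \<Rightarrow> ('n \<Rightarrow> bool list) \<Rightarrow> 'n set \<Rightarrow> bool list"
  where "broadcast enc x = (\<lambda>J\<in>servers. enc J (restrict x J))"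

text \<open>
  Encoders and decoders only see restrictions of the message tuple (and of the broadcast
  tuple), so that each is a function of exactly the data available to it.
\<close>

definition index_code ::
  "('n::finite \<Rightarrow> 'n set) \<Rightarrow> ('n \<Rightarrow> nat) \<Rightarrow> ('n set \<Rightarrow> nat)
    \<Rightarrow> ('n set \<Rightarrow> ('n \<Rightarrow> bool list) \<Rightarrow> bool list)
    \<Rightarrow> ('n \<Rightarrow> ('n set \<Rightarrow> bool list) \<Rightarrow> ('n \<Rightarrow> bool list) \<Rightarrow> bool list) \<Rightarrow> bool"
  where "index_code A t u enc dec \<longleftrightarrow>
    (\<forall>x\<in>messages t.
      (\<forall>J\<in>servers. length (broadcast enc x J) = u J) \<and>
      (\<forall>j. dec j (broadcast enc x) (restrict x (A j)) = x j))"

definition achievable ::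
  "('n::finite \<Rightarrow> 'n set) \<Rightarrow> real ^ 'n \<Rightarrow> ('n set \<Rightarrow> real) \<Rightarrow> bool"
  where "achievable A R C \<longleftrightarrow>
    (\<exists>t u enc dec. \<exists>r::real. index_code A t u enc dec \<and> r > 0 \<and>
      (\<forall>j. R $ j \<le> real (t j) / r) \<and>
      (\<forall>J\<in>servers. C J \<ge> real (u J) / r))"

definition capacity_region ::
  "('n::finite \<Rightarrow> 'n set) \<Rightarrow> ('n set \<Rightarrow> real) \<Rightarrow> (real ^ 'n) set"
  where "capacity_region A C = closure {R. (\<forall>j. R $ j \<ge> 0) \<and> achievable A R C}"

end

theory Submission
  imports Defs
begin

text \<open>
  Random binary linear composite coding. Server \<open>J\<close> hashes the messages in each \<open>K \<subseteq> J\<close> to a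
  composite of slightly fewer than \<open>r C\<^bsub>K,J\<^esub>\<close> parity bits, and then broadcasts about \<open>r C\<^bsub>J\<^esub>\<close>
  parity bits of all its composites together. By linearity, zero-error decoding means that no
  nonzero difference of two message tuples is annihilated by all parities. A fixed difference that
  is seen by \<open>m\<close> random parities survives with probability \<open>2\<^sup>-\<^sup>m\<close>, so the union bound yields
  a good choice of parities: the server constraints let receiver \<open>j\<close> recover every composite not
  determined by its side information, and the receiver constraint for \<open>L\<close> excludes the differences
  that on \<open>D\<^sub>j - A\<^sub>j\<close> are supported exactly on \<open>L\<close>. Thus \<open>R\<close> itself is already achievable.
\<close>

section \<open>Linear algebra over GF(2) and random parity tests\<close>

text \<open>With sets read as GF(2) vectors, \<open>sym_diff\<close> is addition and the parity of
  \<open>card (h \<inter> S)\<close> is an inner product. Additivity holds because the part of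
  \<open>h\<close> in both sets is counted twice.\<close>

lemma odd_card_Int_sym_diff:
  assumes "finite S" "finite T"
  shows "odd (card (h \<inter> sym_diff S T)) \<longleftrightarrow> odd (card (h \<inter> S)) \<noteq> odd (card (h \<inter> T))"
proof -
  have fin: "finite (h \<inter> (S - T))" "finite (h \<inter> (T - S))" "finite (h \<inter> S \<inter> T)"
    using assms by auto
  have 1: "card (h \<inter> sym_diff S T) = card (h \<inter> (S - T)) + card (h \<inter> (T - S))"
    unfolding Int_Un_distrib by (rule card_Un_disjoint) (use fin in auto)
  have "h \<inter> S = h \<inter> (S - T) \<union> h \<inter> S \<inter> T" by auto
  then have 2: "card (h \<inter> S) = card (h \<inter> (S - T)) + card (h \<inter> S \<inter> T)"
    using card_Un_disjoint[OF fin(1,3)] by auto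
  have "h \<inter> T = h \<inter> (T - S) \<union> h \<inter> S \<inter> T" by auto
  then have 3: "card (h \<inter> T) = card (h \<inter> (T - S)) + card (h \<inter> S \<inter> T)"
    using card_Un_disjoint[OF fin(2,3)] by auto
  show ?thesis unfolding 1 2 3 by presburger
qed

text \<open>Toggling one fixed \<open>a \<in> v\<close> is an involution on \<open>Pow U\<close>
  that flips the parity of the intersection with \<open>v\<close>, so even and odd tests are equally
  many.\<close>

lemma card_even_Int:
  assumes "finite U" "v \<subseteq> U" "v \<noteq> {}"
  shows "2 * card {h \<in> Pow U. even (card (h \<inter> v))} = 2 ^ card U"
proof -
  obtain a where a: "a \<in> v" using assms by auto
  let ?E = "{h \<in> Pow U. even (card (h \<inter> v))}" and ?O = "{h \<in> Pow U. odd (card (h \<inter> v))}"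
  let ?f = "\<lambda>h. sym_diff h {a}"
  have flip: "odd (card (?f h \<inter> v)) \<longleftrightarrow> even (card (h \<inter> v))" if "h \<subseteq> U" for h
  proof -
    have "odd (card (v \<inter> ?f h)) \<longleftrightarrow> odd (card (v \<inter> h)) \<noteq> odd (card (v \<inter> {a}))"
      by (rule odd_card_Int_sym_diff) (use that assms finite_subset in auto)
    moreover have "v \<inter> {a} = {a}" using a by auto
    ultimately show ?thesis by (simp add: Int_commute)
  qed
  have sub: "?f h \<subseteq> U" if "h \<subseteq> U" for h using that a assms by auto
  have "bij_betw ?f ?E ?O"
  proof (rule bij_betw_byWitness[where f' = ?f])
    show "?f ` ?E \<subseteq> ?O" using flip sub by blast
    show "?f ` ?O \<subseteq> ?E" using flip sub by blast
  qed auto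
  then have eq: "card ?E = card ?O" by (rule bij_betw_same_card)
  have "card (?E \<union> ?O) = card ?E + card ?O"
    by (rule card_Un_disjoint) (use assms in auto)
  moreover have "?E \<union> ?O = Pow U" by auto
  ultimately show ?thesis using eq assms by (simp add: card_Pow)
qed

text \<open>
  Method of conditional expectations: a uniformly random \<open>h \<subseteq> U\<close> meets a fixed nonempty subset
  of \<open>U\<close> in an even number of points with probability \<open>1/2\<close>.
\<close>

lemma exists_parity_tests_card:
  fixes v :: "'r \<Rightarrow> 'b \<Rightarrow> 'c set"
  assumes "finite I" "finite U" "finite B" "\<And>i b. i \<in> I \<Longrightarrow> b \<in> B \<Longrightarrow> v i b \<subseteq> U"
  shows "\<exists>h. real (card {b \<in> B. \<forall>i\<in>I. even (card (h i \<inter> v i b))})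
    \<le> (\<Sum>b\<in>B. (1/2) ^ card {i \<in> I. v i b \<noteq> {}})"
  using assms
proof (induction I arbitrary: B rule: finite_induct)
  case empty
  then show ?case by auto
next
  case (insert i I)
  \<comment> \<open>For independent uniform tests, \<open>\<phi> b\<close> is the probability that
    \<open>b\<close> survives those in \<open>I\<close>, and \<open>\<psi> b\<close> the probability
    that it also survives test \<open>i\<close>.\<close>
  define \<phi> :: "'b \<Rightarrow> real" where "\<phi> b = (1/2) ^ card {i \<in> I. v i b \<noteq> {}}" for b
  define \<psi> :: "'b \<Rightarrow> real" where "\<psi> b = (1/2) ^ card {k \<in> insert i I. v k b \<noteq> {}}" for b
  let ?E = "\<lambda>b. {h \<in> Pow U. even (card (h \<inter> v i b))}"
  have count: "real (card (?E b)) * \<phi> b = 2 ^ card U * \<psi> b" if "b \<in> B" for b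
  proof (cases "v i b = {}")
    case True
    then have "{k \<in> insert i I. v k b \<noteq> {}} = {i \<in> I. v i b \<noteq> {}}" by auto
    moreover have "?E b = Pow U" using True by auto
    ultimately show ?thesis
      using insert.prems(1) unfolding \<phi>_def \<psi>_def by (simp add: card_Pow)
  next
    case False
    then have "{k \<in> insert i I. v k b \<noteq> {}} = insert i {i \<in> I. v i b \<noteq> {}}" by auto
    then have "\<psi> b = \<phi> b / 2" unfolding \<phi>_def \<psi>_def using insert.hyps by simp
    moreover have "real (2 * card (?E b)) = 2 ^ card U"
      using card_even_Int[OF insert.prems(1) insert.prems(3)[of i b] False] that by simp
    ultimately show ?thesis unfolding of_nat_mult by (simp only: times_divide_eq_right) simp
  qed
  \<comment> \<open>Averaged over all \<open>g\<close>, the left side equals the right side, so some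
    \<open>g\<close> does at least as well as the average.\<close>
  have "\<exists>g\<in>Pow U. (\<Sum>b | b \<in> B \<and> even (card (g \<inter> v i b)). \<phi> b) \<le> (\<Sum>b\<in>B. \<psi> b)"
  proof (rule ccontr)
    assume "\<not> ?thesis"
    then have "(\<Sum>g\<in>Pow U. \<Sum>b\<in>B. \<psi> b)
        < (\<Sum>g\<in>Pow U. \<Sum>b | b \<in> B \<and> even (card (g \<inter> v i b)). \<phi> b)"
      using insert.prems(1) by (intro sum_strict_mono) (auto simp: not_le)
    also have "\<dots> = (\<Sum>b\<in>B. \<Sum>g | g \<in> Pow U \<and> even (card (g \<inter> v i b)). \<phi> b)"
      using insert.prems(1,2) by (intro sum.swap_restrict) auto
    also have "\<dots> = (\<Sum>b\<in>B. 2 ^ card U * \<psi> b)"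
      using count by (intro sum.cong) auto
    also have "\<dots> = (\<Sum>g\<in>Pow U. \<Sum>b\<in>B. \<psi> b)"
      using insert.prems(1) by (simp add: card_Pow sum_distrib_left)
    finally show False by simp
  qed
  then obtain g where g: "(\<Sum>b | b \<in> B \<and> even (card (g \<inter> v i b)). \<phi> b) \<le> (\<Sum>b\<in>B. \<psi> b)"
    by auto
  \<comment> \<open>Only the survivors of \<open>g\<close> are passed on to the remaining tests;
    hence the induction over arbitrary \<open>B\<close>.\<close>
  let ?B = "{b \<in> B. even (card (g \<inter> v i b))}"
  obtain h where h: "real (card {b \<in> ?B. \<forall>i\<in>I. even (card (h i \<inter> v i b))}) \<le> (\<Sum>b\<in>?B. \<phi> b)"
    using insert.IH[of ?B] insert.prems unfolding \<phi>_def by auto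
  have "{b \<in> B. \<forall>k\<in>insert i I. even (card ((h(i := g)) k \<inter> v k b))}
      = {b \<in> ?B. \<forall>i\<in>I. even (card (h i \<inter> v i b))}"
    using insert.hyps by auto
  with h g show ?case unfolding \<psi>_def by (intro exI[of _ "h(i := g)"]) simp
qed

text \<open>A number of survivors below 1 is zero: every \<open>b\<close> is detected by some
  test.\<close>

lemma exists_parity_tests:
  fixes v :: "'r \<Rightarrow> 'b \<Rightarrow> 'c set"
  assumes "finite I" "finite U" "finite B" "\<And>i b. i \<in> I \<Longrightarrow> b \<in> B \<Longrightarrow> v i b \<subseteq> U"
    and small: "(\<Sum>b\<in>B. (1/2::real) ^ card {i \<in> I. v i b \<noteq> {}}) < 1"
  shows "\<exists>h. \<forall>b\<in>B. \<exists>i\<in>I. odd (card (h i \<inter> v i b))"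
proof -
  obtain h where "real (card {b \<in> B. \<forall>i\<in>I. even (card (h i \<inter> v i b))})
      \<le> (\<Sum>b\<in>B. (1/2) ^ card {i \<in> I. v i b \<noteq> {}})"
    using exists_parity_tests_card[of I U B v] assms(1-4) by blast
  with small have "card {b \<in> B. \<forall>i\<in>I. even (card (h i \<inter> v i b))} = 0" by linarith
  with assms(3) show ?thesis by (intro exI[of _ h]) auto
qed

section \<open>Union bounds for the two coding stages\<close>

text \<open>One server's broadcast must serve all receivers at once. Receiver \<open>j\<close> has
  fewer than \<open>2 ^ card (V j)\<close> nonzero differences, each missed by \<open>u\<close>
  random tests with probability 2^(-u). The extra \<open>CARD('n)\<close> tests leave n 2^(-n) < 1
  over all n receivers. The guard in \<open>len\<close> permits \<open>u = 0\<close> when no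
  receiver has anything to learn.\<close>

lemma exists_flat_code:
  fixes V :: "'n::finite \<Rightarrow> 'c set"
  assumes fin: "\<And>j. finite (V j)"
    and len: "\<And>j. V j \<noteq> {} \<Longrightarrow> card (V j) + CARD('n) \<le> u"
  shows "\<exists>g. \<forall>j w. w \<subseteq> V j \<longrightarrow> w \<noteq> {} \<longrightarrow> (\<exists>l<u. odd (card (g l \<inter> w)))"
proof -
  define B where "B = (SIGMA j:UNIV. Pow (V j) - {{}})"
  have rows: "(1/2::real) ^ card {i \<in> {..<u}. snd b \<noteq> {}} = (1/2) ^ u" if "b \<in> B" for b
  proof -
    from that have "{i \<in> {..<u}. snd b \<noteq> {}} = {..<u}" by (auto simp: B_def)
    then show ?thesis by simp
  qed
  have each: "(\<Sum>w\<in>Pow (V j) - {{}}. (1/2::real) ^ u) \<le> (1/2) ^ CARD('n)" for j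
  proof (cases "V j = {}")
    case False
    have "(\<Sum>w\<in>Pow (V j) - {{}}. (1/2::real) ^ u) \<le> (\<Sum>w\<in>Pow (V j). (1/2) ^ u)"
      using fin by (intro sum_mono2) auto
    also have "\<dots> = 2 ^ card (V j) * (1/2) ^ u"
      using fin by (simp add: card_Pow)
    also have "\<dots> \<le> 2 ^ card (V j) * (1/2) ^ (card (V j) + CARD('n))"
      using len[OF False] by (intro mult_left_mono power_decreasing) auto
    also have "\<dots> = (1/2) ^ CARD('n)"
      by (simp add: power_add power_one_over)
    finally show ?thesis .
  qed simp
  have "(\<Sum>b\<in>B. (1/2::real) ^ card {i \<in> {..<u}. snd b \<noteq> {}}) = (\<Sum>b\<in>B. (1/2) ^ u)"
    using rows by (intro sum.cong) auto
  also have "\<dots> = (\<Sum>j\<in>UNIV. \<Sum>w\<in>Pow (V j) - {{}}. (1/2) ^ u)"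
    unfolding B_def using fin by (subst sum.Sigma) (auto simp: split_def)
  also have "\<dots> \<le> (\<Sum>j\<in>(UNIV::'n set). (1/2) ^ CARD('n))"
    by (intro sum_mono each)
  also have "\<dots> = real CARD('n) / 2 ^ CARD('n)"
    by (simp add: power_one_over field_simps)
  also have "\<dots> < 1"
    using less_exp[of "CARD('n)"] by simp
  finally have "\<exists>g. \<forall>b\<in>B. \<exists>l\<in>{..<u}. odd (card (g l \<inter> snd b))"
    by (intro exists_parity_tests[where U = "\<Union>j. V j"]) (auto simp: B_def fin)
  then obtain g where g: "\<And>b. b \<in> B \<Longrightarrow> \<exists>l\<in>{..<u}. odd (card (g l \<inter> snd b))" by blast
  show ?thesis
  proof (intro exI[of _ g] allI impI)
    fix j w assume "w \<subseteq> V j" "w \<noteq> {}"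
    then show "\<exists>l<u. odd (card (g l \<inter> w))" using g[of "(j, w)"] by (auto simp: B_def)
  qed
qed

text \<open>The triple \<open>(K, J, l)\<close> addresses bit \<open>l\<close> of the composite of
  \<open>K\<close> at server \<open>J\<close>; in the application \<open>E j\<close> is
  \<open>D j - A j\<close> and \<open>F j\<close> is \<open>D j \<union> A j\<close>. In the union
  bound over differences \<open>z\<close>, one summand \<open>CARD('n)\<close> of \<open>gap\<close>
  pays for the 2^n possible supports, the other for the n receivers.\<close>

lemma exists_composite_hashes:
  fixes E F :: "'n::finite \<Rightarrow> 'n set" and t :: "'n \<Rightarrow> nat" and s :: "'n set \<Rightarrow> 'n set \<Rightarrow> nat"
  assumes gap: "\<And>j L. L \<noteq> {} \<Longrightarrow> L \<subseteq> E j \<Longrightarrow> sum t L + 2 * CARD('n) \<le>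
      (\<Sum>K | K \<subseteq> F j \<and> K \<inter> L \<noteq> {}. \<Sum>J | J \<in> servers \<and> K \<subseteq> J. s K J)"
  shows "\<exists>h :: 'n set \<times> 'n set \<times> nat \<Rightarrow> ('n \<times> nat) set.
    \<forall>j z. z \<subseteq> (SIGMA i:E j. {..<t i}) \<longrightarrow> z \<noteq> {} \<longrightarrow>
      (\<exists>K J l. K \<noteq> {} \<and> K \<subseteq> J \<and> K \<subseteq> F j \<and> l < s K J \<and>
        odd (card (h (K, J, l) \<inter> {p \<in> z. fst p \<in> K})))"
proof -
  define I where "I = (SIGMA K:-{{}}. SIGMA J:{J. K \<subseteq> J}. {..<s K J})"
  define Z where "Z j = (SIGMA i:E j. {..<t i})" for j
  define B where "B = (SIGMA j:UNIV. Pow (Z j) - {{}})"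
  \<comment> \<open>The empty set disables composites that receiver \<open>fst b\<close> does not
    use: such a test is always even and contributes no factor 1/2.\<close>
  define v where "v i b = (if fst i \<subseteq> F (fst b) then {p \<in> snd b. fst p \<in> fst i} else {})"
    for i :: "'n set \<times> 'n set \<times> nat" and b :: "'n \<times> ('n \<times> nat) set"
  let ?n = "CARD('n)"
  have finI: "finite I" unfolding I_def by (intro finite_SigmaI) auto
  have finZ: "finite (Z j)" for j unfolding Z_def by (intro finite_SigmaI) auto
  have term_le: "(1/2::real) ^ card {i \<in> I. v i (j, z) \<noteq> {}} \<le> (1/2) ^ (sum t (fst ` z) + 2 * ?n)"
    if z: "z \<subseteq> Z j" "z \<noteq> {}" for j z
  proof -
    have "{i \<in> I. v i (j, z) \<noteq> {}} =
        (SIGMA K:{K. K \<subseteq> F j \<and> K \<inter> fst ` z \<noteq> {}}. SIGMA J:{J. J \<in> servers \<and> K \<subseteq> J}. {..<s K J})"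
      unfolding I_def v_def servers_def by (auto simp: image_iff) force+
    then have "card {i \<in> I. v i (j, z) \<noteq> {}} =
        (\<Sum>K | K \<subseteq> F j \<and> K \<inter> fst ` z \<noteq> {}. \<Sum>J | J \<in> servers \<and> K \<subseteq> J. s K J)"
      by simp
    moreover have "fst ` z \<noteq> {}" "fst ` z \<subseteq> E j" using z unfolding Z_def by auto
    ultimately show ?thesis using gap[of "fst ` z" j] by (intro power_decreasing) auto
  qed
  have each: "(\<Sum>z\<in>Pow (Z j) - {{}}. (1/2::real) ^ card {i \<in> I. v i (j, z) \<noteq> {}}) \<le> (1/2) ^ ?n" for j
  proof -
    have "(\<Sum>z\<in>Pow (Z j) - {{}}. (1/2::real) ^ card {i \<in> I. v i (j, z) \<noteq> {}})
        \<le> (\<Sum>z\<in>Pow (Z j) - {{}}. (1/2) ^ (sum t (fst ` z) + 2 * ?n))"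
      using term_le by (intro sum_mono) auto
    also have "\<dots> \<le> (\<Sum>z\<in>Pow (Z j). (1/2) ^ (sum t (fst ` z) + 2 * ?n))"
      using finZ by (intro sum_mono2) auto
    \<comment> \<open>Group by support: at most \<open>2 ^ sum t L\<close> differences have support
      \<open>L\<close>, which cancels the \<open>sum t L\<close> in the exponent.\<close>
    also have "\<dots> = (\<Sum>L\<in>UNIV. \<Sum>z | z \<in> Pow (Z j) \<and> fst ` z = L. (1/2) ^ (sum t (fst ` z) + 2 * ?n))"
      using finZ by (intro sum.group[symmetric]) auto
    also have "\<dots> \<le> (\<Sum>L\<in>(UNIV::'n set set). (1/2) ^ (2 * ?n))"
    proof (intro sum_mono)
      fix L :: "'n set"
      have "{z. z \<in> Pow (Z j) \<and> fst ` z = L} \<subseteq> Pow (SIGMA i:L. {..<t i})"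
        unfolding Z_def by (auto simp: image_iff) force+
      then have "card {z. z \<in> Pow (Z j) \<and> fst ` z = L} \<le> card (Pow (SIGMA i:L. {..<t i}))"
        by (intro card_mono) auto
      also have "\<dots> = 2 ^ sum t L" by (simp add: card_Pow)
      finally have c: "real (card {z. z \<in> Pow (Z j) \<and> fst ` z = L}) \<le> 2 ^ sum t L"
        by (metis of_nat_le_iff of_nat_numeral of_nat_power)
      have "(\<Sum>z | z \<in> Pow (Z j) \<and> fst ` z = L. (1/2::real) ^ (sum t (fst ` z) + 2 * ?n))
          = real (card {z. z \<in> Pow (Z j) \<and> fst ` z = L}) * (1/2) ^ (sum t L + 2 * ?n)"
        by simp
      also have "\<dots> \<le> 2 ^ sum t L * (1/2) ^ (sum t L + 2 * ?n)"
        using c by (intro mult_right_mono) auto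
      also have "\<dots> = (1/2) ^ (2 * ?n)" by (simp add: power_add power_one_over)
      finally show "(\<Sum>z | z \<in> Pow (Z j) \<and> fst ` z = L. (1/2::real) ^ (sum t (fst ` z) + 2 * ?n))
          \<le> (1/2) ^ (2 * ?n)" .
    qed
    also have "\<dots> = (1/2) ^ ?n"
      by (simp add: card_UNIV_set power_one_over mult_2 power_add)
    finally show ?thesis .
  qed
  have "(\<Sum>b\<in>B. (1/2::real) ^ card {i \<in> I. v i b \<noteq> {}})
      = (\<Sum>j\<in>UNIV. \<Sum>z\<in>Pow (Z j) - {{}}. (1/2) ^ card {i \<in> I. v i (j, z) \<noteq> {}})"
    unfolding B_def using finZ by (subst sum.Sigma) (auto simp: split_def)
  also have "\<dots> \<le> (\<Sum>j\<in>(UNIV::'n set). (1/2) ^ ?n)"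
    by (intro sum_mono each)
  also have "\<dots> = real ?n / 2 ^ ?n"
    by (simp add: power_one_over field_simps)
  also have "\<dots> < 1"
    using less_exp[of ?n] by simp
  finally have "\<exists>h. \<forall>b\<in>B. \<exists>i\<in>I. odd (card (h i \<inter> v i b))"
    by (intro exists_parity_tests[where U = "\<Union>j. Z j"]) (auto simp: B_def finI finZ v_def)
  then obtain h where h: "\<And>b. b \<in> B \<Longrightarrow> \<exists>i\<in>I. odd (card (h i \<inter> v i b))" by blast
  show ?thesis
  proof (intro exI[of _ h] allI impI)
    fix j z assume "z \<subseteq> (SIGMA i:E j. {..<t i})" "z \<noteq> {}"
    then have "(j, z) \<in> B" unfolding B_def Z_def by auto
    from h[OF this] obtain K J l where "(K, J, l) \<in> I" "odd (card (h (K, J, l) \<inter> v (K, J, l) (j, z)))"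
      by (auto simp: I_def)
    then show "\<exists>K J l. K \<noteq> {} \<and> K \<subseteq> J \<and> K \<subseteq> F j \<and> l < s K J \<and>
        odd (card (h (K, J, l) \<inter> {p \<in> z. fst p \<in> K}))"
      unfolding I_def v_def by (intro exI[of _ K] exI[of _ J] exI[of _ l]) (auto split: if_splits)
  qed
qed

section \<open>The two-stage linear index code\<close>

text \<open>The decoder picks any message tuple consistent with the data of receiver
  \<open>j\<close>; by \<open>inj\<close> all candidates agree at \<open>j\<close>.\<close>

lemma index_code_if_decodable:
  assumes len: "\<And>x J. x \<in> messages t \<Longrightarrow> J \<in> servers \<Longrightarrow> length (broadcast enc x J) = u J"
    and inj: "\<And>x x' j. x \<in> messages t \<Longrightarrow> x' \<in> messages t \<Longrightarrow> broadcast enc x = broadcast enc x' \<Longrightarrow>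
      restrict x (A j) = restrict x' (A j) \<Longrightarrow> x j = x' j"
  shows "\<exists>dec. index_code A t u enc dec"
proof -
  define P where "P j y a x \<longleftrightarrow> x \<in> messages t \<and> broadcast enc x = y \<and> restrict x (A j) = a"
    for j y a x
  define dec where "dec j y a = (SOME x. P j y a x) j" for j y a
  have "dec j (broadcast enc x) (restrict x (A j)) = x j" if x: "x \<in> messages t" for x j
  proof -
    have "P j (broadcast enc x) (restrict x (A j)) x" using x by (simp add: P_def)
    then have "P j (broadcast enc x) (restrict x (A j))
        (SOME x'. P j (broadcast enc x) (restrict x (A j)) x')"
      by (rule someI[where P = "P j (broadcast enc x) (restrict x (A j))"])
    then show ?thesis unfolding dec_def P_def using inj x by blast
  qed
  then have "index_code A t u enc dec" unfolding index_code_def using len by blast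
  then show ?thesis by blast
qed

text \<open>The positions of the one bits, so that the difference of two message tuples is a
  \<open>sym_diff\<close>.\<close>

definition bits :: "('n \<Rightarrow> nat) \<Rightarrow> ('n \<Rightarrow> bool list) \<Rightarrow> ('n \<times> nat) set"
  where "bits t x = {(i, l). l < t i \<and> x i ! l}"

lemma finite_bits: "finite (bits (t :: 'n::finite \<Rightarrow> nat) x)"
  by (rule finite_subset[of _ "SIGMA i:UNIV. {..<t i}"]) (auto simp: bits_def)

text \<open>Again a set of one bits, so that the broadcast can apply parity tests to it in
  turn.\<close>

definition composites ::
  "('n::finite \<Rightarrow> nat) \<Rightarrow> ('n set \<Rightarrow> 'n set \<Rightarrow> nat) \<Rightarrow> ('n set \<times> 'n set \<times> nat \<Rightarrow> ('n \<times> nat) set)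
    \<Rightarrow> 'n set \<Rightarrow> ('n \<Rightarrow> bool list) \<Rightarrow> ('n set \<times> nat) set"
  where "composites t s h J x = {(K, l). K \<noteq> {} \<and> K \<subseteq> J \<and> l < s K J \<and>
    odd (card (h (K, J, l) \<inter> {p \<in> bits t x. fst p \<in> K}))}"

lemma finite_composites: "finite (composites t s h J x)"
  by (rule finite_subset[of _ "SIGMA K:UNIV. {..<s K J}"]) (auto simp: composites_def)

lemma bits_restrict_cong:
  assumes "restrict x S = restrict x' S" "K \<subseteq> S"
  shows "{p \<in> bits t x. fst p \<in> K} = {p \<in> bits t x'. fst p \<in> K}"
proof -
  have "x i = x' i" if "i \<in> K" for i
    using assms that by (metis restrict_apply' subsetD)
  then show ?thesis by (auto simp: bits_def)
qed

lemma composites_restrict: "composites t s h J (restrict x J) = composites t s h J x"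
proof -
  have "{p \<in> bits t (restrict x J). fst p \<in> K} = {p \<in> bits t x. fst p \<in> K}" if "K \<subseteq> J" for K
    using that by (intro bits_restrict_cong[of _ J]) auto
  then show ?thesis by (auto simp: composites_def)
qed

text \<open>For two tuples that receiver \<open>j\<close> cannot tell apart, \<open>g\<close> forces
  equal composites at every server, and then \<open>h\<close> forces equal messages on
  \<open>D j\<close>. The terms \<open>CARD('n)\<close> and \<open>2 * CARD('n)\<close> are the
  costs of the two union bounds.\<close>

lemma exists_index_code:
  fixes A D :: "'n::finite \<Rightarrow> 'n set" and t :: "'n \<Rightarrow> nat"
    and s :: "'n set \<Rightarrow> 'n set \<Rightarrow> nat" and u :: "'n set \<Rightarrow> nat"
  assumes A: "\<And>j. j \<notin> A j" and D: "\<And>j. j \<in> D j"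
    and server: "\<And>j J. J \<in> servers \<Longrightarrow> (\<Sum>K | K \<noteq> {} \<and> K \<subseteq> J \<and> \<not> K \<subseteq> A j. s K J) \<noteq> 0 \<Longrightarrow>
      (\<Sum>K | K \<noteq> {} \<and> K \<subseteq> J \<and> \<not> K \<subseteq> A j. s K J) + CARD('n) \<le> u J"
    and receiver: "\<And>j L. L \<noteq> {} \<Longrightarrow> L \<subseteq> D j - A j \<Longrightarrow> sum t L + 2 * CARD('n) \<le>
      (\<Sum>K | K \<subseteq> D j \<union> A j \<and> K \<inter> L \<noteq> {}. \<Sum>J | J \<in> servers \<and> K \<subseteq> J. s K J)"
  shows "\<exists>enc dec. index_code A t u enc dec"
proof -
  obtain h :: "'n set \<times> 'n set \<times> nat \<Rightarrow> ('n \<times> nat) set"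
    where h: "\<And>j z. z \<subseteq> (SIGMA i:D j - A j. {..<t i}) \<Longrightarrow> z \<noteq> {} \<Longrightarrow>
      \<exists>K J l. K \<noteq> {} \<and> K \<subseteq> J \<and> K \<subseteq> D j \<union> A j \<and> l < s K J \<and>
        odd (card (h (K, J, l) \<inter> {p \<in> z. fst p \<in> K}))"
    using exists_composite_hashes
      [where E = "\<lambda>j. D j - A j" and F = "\<lambda>j. D j \<union> A j" and t = t and s = s, OF receiver] by blast
  \<comment> \<open>The composite bits at server \<open>J\<close> that the side information of
    receiver \<open>j\<close> does not determine.\<close>
  define V where "V J j = (SIGMA K:{K. K \<noteq> {} \<and> K \<subseteq> J \<and> \<not> K \<subseteq> A j}. {..<s K J})" for J j
  have "\<exists>g. \<forall>j w. w \<subseteq> V J j \<longrightarrow> w \<noteq> {} \<longrightarrow> (\<exists>l<u J. odd (card (g l \<inter> w)))" if J: "J \<in> servers" for J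
  proof (rule exists_flat_code)
    show fin: "finite (V J j)" for j unfolding V_def by (intro finite_SigmaI) auto
    have "card (V J j) = (\<Sum>K | K \<noteq> {} \<and> K \<subseteq> J \<and> \<not> K \<subseteq> A j. s K J)" for j
      unfolding V_def by simp
    then show "card (V J j) + CARD('n) \<le> u J" if "V J j \<noteq> {}" for j
      using server[OF J, of j] that fin[of j] by (metis card_0_eq)
  qed
  then obtain g where g: "\<And>J j w. J \<in> servers \<Longrightarrow> w \<subseteq> V J j \<Longrightarrow> w \<noteq> {} \<Longrightarrow>
      \<exists>l<u J. odd (card (g J l \<inter> w))"
    by metis
  define enc where "enc J x = map (\<lambda>l. odd (card (g J l \<inter> composites t s h J x))) [0..<u J]" for J x
  have bc: "broadcast enc x J = map (\<lambda>l. odd (card (g J l \<inter> composites t s h J x))) [0..<u J]"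
    if "J \<in> servers" for x J
    using that by (simp add: broadcast_def enc_def composites_restrict)
  have "\<exists>dec. index_code A t u enc dec"
  proof (rule index_code_if_decodable)
    show "length (broadcast enc x J) = u J" if "J \<in> servers" for x J
      using that by (simp add: bc)
  next
    fix x x' j
    assume x: "x \<in> messages t" "x' \<in> messages t"
      and eq: "broadcast enc x = broadcast enc x'" "restrict x (A j) = restrict x' (A j)"
    have comp: "composites t s h J x = composites t s h J x'" if J: "J \<in> servers" for J
    proof (rule ccontr)
      let ?w = "sym_diff (composites t s h J x) (composites t s h J x')"
      assume "composites t s h J x \<noteq> composites t s h J x'"
      then have "?w \<noteq> {}" by auto
      \<comment> \<open>Composites with \<open>K \<subseteq> A j\<close> agree, since
        \<open>x\<close> and \<open>x'\<close> agree on \<open>A j\<close>.\<close>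
      moreover have "?w \<subseteq> V J j"
        using bits_restrict_cong[OF eq(2)] by (auto simp: composites_def V_def)
      ultimately obtain l where l: "l < u J" "odd (card (g J l \<inter> ?w))" using g[OF J] by blast
      have "broadcast enc x J ! l = broadcast enc x' J ! l" using eq(1) by simp
      then show False
        using l J by (simp add: bc odd_card_Int_sym_diff[OF finite_composites finite_composites])
    qed
    define z where "z = {p \<in> sym_diff (bits t x) (bits t x'). fst p \<in> D j}"
    have notA: "fst p \<notin> A j" if "p \<in> sym_diff (bits t x) (bits t x')" for p
      using that bits_restrict_cong[OF eq(2) order.refl, of t] by blast
    have "z = {}"
    proof (rule ccontr)
      assume ne: "z \<noteq> {}"
      have sub: "z \<subseteq> (SIGMA i:D j - A j. {..<t i})"
      proof
        fix p assume "p \<in> z"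
        then have "p \<in> sym_diff (bits t x) (bits t x')" "fst p \<in> D j" by (simp_all add: z_def)
        with notA[of p] show "p \<in> (SIGMA i:D j - A j. {..<t i})"
          by (cases p) (auto simp: bits_def)
      qed
      from h[OF sub ne] obtain K J l where K: "K \<noteq> {}" "K \<subseteq> J" "K \<subseteq> D j \<union> A j" "l < s K J"
        and odd: "odd (card (h (K, J, l) \<inter> {p \<in> z. fst p \<in> K}))"
        by blast
      let ?S = "{p \<in> bits t x. fst p \<in> K}" and ?T = "{p \<in> bits t x'. fst p \<in> K}"
      have J: "J \<in> servers" using K by (auto simp: servers_def)
      \<comment> \<open>The difference vanishes on \<open>A j\<close> and
        \<open>K \<subseteq> D j \<union> A j\<close>, so cutting down to \<open>D j\<close> loses
        nothing within \<open>K\<close>.\<close>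
      have "{p \<in> z. fst p \<in> K} = sym_diff ?S ?T"
        using K(3) notA unfolding z_def by blast
      with odd have "odd (card (h (K, J, l) \<inter> sym_diff ?S ?T))" by simp
      moreover have "finite ?S" "finite ?T"
        by (rule rev_finite_subset[OF finite_bits], blast)+
      ultimately have "odd (card (h (K, J, l) \<inter> ?S)) \<noteq> odd (card (h (K, J, l) \<inter> ?T))"
        by (blast dest: odd_card_Int_sym_diff[THEN iffD1])
      moreover have "(K, l) \<in> composites t s h J x \<longleftrightarrow> (K, l) \<in> composites t s h J x'"
        using comp[OF J] by simp
      ultimately show False using K by (simp add: composites_def)
    qed
    then have "(j, l) \<notin> z" for l by simp
    then have "(j, l) \<in> bits t x \<longleftrightarrow> (j, l) \<in> bits t x'" for l
      using D[of j] by (simp add: z_def) blast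
    then show "x j = x' j"
      using x by (intro nth_equalityI) (auto simp: messages_def bits_def)
  qed
  then show ?thesis by blast
qed

section \<open>Rounding the rates to integer lengths\<close>

theorem mainTheorem3:
  fixes A :: "'n::finite \<Rightarrow> 'n set"
    and C :: "'n set \<Rightarrow> real"
    and R :: "real ^ 'n"
    and CC :: "'n set \<Rightarrow> 'n set \<Rightarrow> real"
  assumes side_information: "\<And>j. A j \<subseteq> UNIV - {j}"
    and capacities: "\<And>J. J \<in> servers \<Longrightarrow> C J \<ge> 0"
    and rates: "\<And>j. R $ j \<ge> 0"
    and composite_rates:
      "\<And>J K. J \<in> servers \<Longrightarrow> K \<noteq> {} \<Longrightarrow> K \<subseteq> J \<Longrightarrow> CC K J \<ge> 0"
    and server_constraint:
      "\<And>j J. J \<in> servers \<Longrightarrow>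
        (\<Sum>K | K \<noteq> {} \<and> K \<subseteq> J \<and> \<not> K \<subseteq> A j. CC K J) \<le> C J"
    and receiver_constraint:
      "\<And>j. \<exists>D. j \<in> D \<and>
        (\<forall>L. L \<noteq> {} \<and> L \<subseteq> D - A j \<longrightarrow>
          (\<Sum>i\<in>L. R $ i) <
          (\<Sum>K | K \<subseteq> D \<union> A j \<and> K \<inter> L \<noteq> {}. \<Sum>J | J \<in> servers \<and> K \<subseteq> J. CC K J))"
  shows "R \<in> capacity_region A C"
proof -
  let ?n = "CARD('n)"
  \<comment> \<open>\<open>M\<close> bounds the number of pairs \<open>(K, J)\<close>, hence the
    total loss when the composite lengths are rounded down.\<close>
  define M where "M = real (card (UNIV :: ('n set \<times> 'n set) set))"
  define S where "S F L = (\<Sum>K | K \<subseteq> F \<and> K \<inter> L \<noteq> {}. \<Sum>J | J \<in> servers \<and> K \<subseteq> J. CC K J)" for F L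
  have "\<forall>j. \<exists>D. j \<in> D \<and> (\<forall>L. L \<noteq> {} \<and> L \<subseteq> D - A j \<longrightarrow> (\<Sum>i\<in>L. R $ i) < S (D \<union> A j) L)"
    unfolding S_def using receiver_constraint by (rule allI)
  then obtain D where D: "\<And>j. j \<in> D j"
    and recv: "\<And>j L. L \<noteq> {} \<Longrightarrow> L \<subseteq> D j - A j \<Longrightarrow> (\<Sum>i\<in>L. R $ i) < S (D j \<union> A j) L"
    by metis
  \<comment> \<open>Scaling the composite rates by \<open>1 - d\<close> frees capacity for the
    server overhead; the receiver inequalities, being strict and finite in number, survive for small
    \<open>d\<close>.\<close>
  have "\<forall>\<^sub>F d in at_right (0::real). L \<noteq> {} \<and> L \<subseteq> D j - A j \<longrightarrow> (\<Sum>i\<in>L. R $ i) < (1 - d) * S (D j \<union> A j) L" for j L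
  proof (cases "L \<noteq> {} \<and> L \<subseteq> D j - A j")
    case True
    have "((\<lambda>d. (1 - d) * S (D j \<union> A j) L) \<longlongrightarrow> (1 - 0) * S (D j \<union> A j) L) (at_right 0)"
      by (intro tendsto_intros)
    moreover have "(\<Sum>i\<in>L. R $ i) < (1 - 0) * S (D j \<union> A j) L" using recv True by simp
    ultimately show ?thesis by (auto dest: order_tendstoD(1) elim: eventually_mono)
  qed auto
  then have "\<forall>\<^sub>F d in at_right (0::real). \<forall>j L. L \<noteq> {} \<and> L \<subseteq> D j - A j \<longrightarrow> (\<Sum>i\<in>L. R $ i) < (1 - d) * S (D j \<union> A j) L"
    by (intro eventually_all_finite)
  moreover have "\<forall>\<^sub>F d in at_right (0::real). 0 < d \<and> d < 1"
    using eventually_at_right_real[of 0 1] by (auto elim: eventually_mono)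
  ultimately have "\<exists>d. (\<forall>j L. L \<noteq> {} \<and> L \<subseteq> D j - A j \<longrightarrow> (\<Sum>i\<in>L. R $ i) < (1 - d) * S (D j \<union> A j) L) \<and>
      0 < d \<and> d < 1"
    by (rule eventually_happens'[OF trivial_limit_at_right_real eventually_conj])
  then obtain d where d: "0 < d" "d < 1"
    and slack: "\<forall>j L. L \<noteq> {} \<and> L \<subseteq> D j - A j \<longrightarrow> (\<Sum>i\<in>L. R $ i) < (1 - d) * S (D j \<union> A j) L"
    by (elim exE conjE) (rule that)
  have lin: "\<forall>\<^sub>F r in at_top. P \<longrightarrow> b \<le> r * a" if "P \<Longrightarrow> a > 0" for P and a b :: real
  proof (cases P)
    case True
    with that have a: "a > 0" by simp
    show ?thesis using eventually_ge_at_top[of "b / a"]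
      by eventually_elim (use a in \<open>simp add: field_simps\<close>)
  qed simp
  \<comment> \<open>Of \<open>3 * real ?n\<close>, one n covers rounding up the \<open>t i\<close>
    and two n are the overhead of the hashes; \<open>M\<close> covers rounding down
    \<open>s\<close>.\<close>
  have "\<forall>\<^sub>F r in at_top. \<forall>j L. L \<noteq> {} \<and> L \<subseteq> D j - A j \<longrightarrow>
      3 * real ?n + M \<le> r * ((1 - d) * S (D j \<union> A j) L - (\<Sum>i\<in>L. R $ i))"
    by (intro eventually_all_finite lin) (use slack in auto)
  \<comment> \<open>The freed capacity \<open>r * (d * C J)\<close> must cover the overhead n and
    the loss of 1 in rounding down \<open>u J\<close>.\<close>
  moreover have "\<forall>\<^sub>F r in at_top. \<forall>J. C J > 0 \<longrightarrow> real ?n + 1 \<le> r * (d * C J)"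
    by (intro eventually_all_finite lin) (use d in auto)
  moreover have "\<forall>\<^sub>F r in at_top. (r::real) > 0" by (rule eventually_gt_at_top)
  ultimately have "\<exists>r. (\<forall>j L. L \<noteq> {} \<and> L \<subseteq> D j - A j \<longrightarrow>
      3 * real ?n + M \<le> r * ((1 - d) * S (D j \<union> A j) L - (\<Sum>i\<in>L. R $ i))) \<and>
      (\<forall>J. C J > 0 \<longrightarrow> real ?n + 1 \<le> r * (d * C J)) \<and> r > 0"
    by (intro eventually_happens'[OF trivial_limit_at_top_linorder] eventually_conj)
  then obtain r where r: "r > 0"
    and rC: "\<forall>J. C J > 0 \<longrightarrow> real ?n + 1 \<le> r * (d * C J)"
    and rS: "\<forall>j L. L \<noteq> {} \<and> L \<subseteq> D j - A j \<longrightarrow>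
      3 * real ?n + M \<le> r * ((1 - d) * S (D j \<union> A j) L - (\<Sum>i\<in>L. R $ i))"
    by (elim exE conjE) (rule that)
  define t where "t i = nat \<lceil>r * R $ i\<rceil>" for i
  define s where "s K J = nat \<lfloor>(1 - d) * r * CC K J\<rfloor>" for K J
  define u where "u J = nat \<lfloor>r * C J\<rfloor>" for J
  have s_le: "real (s K J) \<le> (1 - d) * r * CC K J" if "J \<in> servers" "K \<noteq> {}" "K \<subseteq> J" for K J
  proof -
    have "0 \<le> (1 - d) * r * CC K J" using composite_rates[OF that] d r by simp
    then show ?thesis unfolding s_def by (simp add: of_nat_floor)
  qed
  have s_ge: "(1 - d) * r * CC K J - 1 \<le> real (s K J)" for K J
    unfolding s_def by linarith
  have t_le: "real (t i) \<le> r * R $ i + 1" for i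
    using rates[of i] r unfolding t_def by simp
  have "\<exists>enc dec. index_code A t u enc dec"
  proof (rule exists_index_code[where D = D and s = s])
    show "j \<notin> A j" for j using side_information by blast
    show "j \<in> D j" for j by (rule D)
  next
    fix j J assume J: "J \<in> servers"
      and nz: "(\<Sum>K | K \<noteq> {} \<and> K \<subseteq> J \<and> \<not> K \<subseteq> A j. s K J) \<noteq> 0"
    let ?X = "{K. K \<noteq> {} \<and> K \<subseteq> J \<and> \<not> K \<subseteq> A j}"
    define N where "N = (\<Sum>K\<in>?X. s K J)"
    have "real N \<le> (\<Sum>K\<in>?X. (1 - d) * r * CC K J)"
      unfolding N_def of_nat_sum using J by (intro sum_mono s_le) auto
    also have "\<dots> = (1 - d) * r * (\<Sum>K\<in>?X. CC K J)" by (simp add: sum_distrib_left)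
    also have "\<dots> \<le> (1 - d) * r * C J"
      using server_constraint[OF J, of j] d r by (intro mult_left_mono) auto
    finally have le: "real N \<le> (1 - d) * r * C J" .
    \<comment> \<open>Zero capacity would give \<open>N = 0\<close> by \<open>le\<close>, against
      \<open>nz\<close>; so a link of zero capacity never has to carry the overhead.\<close>
    have "C J \<noteq> 0" using le nz by (auto simp flip: N_def)
    then have pos: "C J > 0" using capacities[OF J] by simp
    have "real N + real ?n \<le> r * C J - 1"
      using le rC[rule_format, OF pos] by (simp add: algebra_simps)
    then show "(\<Sum>K\<in>?X. s K J) + ?n \<le> u J"
      unfolding N_def[symmetric] u_def by linarith
  next
    fix j and L :: "'n set" assume L: "L \<noteq> {}" "L \<subseteq> D j - A j"
    let ?X = "{K. K \<subseteq> D j \<union> A j \<and> K \<inter> L \<noteq> {}}" and ?Y = "\<lambda>K. {J. J \<in> servers \<and> K \<subseteq> J}"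
    have "real (card L) \<le> real ?n" by (simp add: card_mono)
    moreover have "real (sum t L) \<le> (\<Sum>i\<in>L. r * R $ i + 1)"
      unfolding of_nat_sum by (intro sum_mono t_le)
    ultimately have "real (sum t L) \<le> r * (\<Sum>i\<in>L. R $ i) + real ?n"
      by (simp add: sum.distrib sum_distrib_left)
    moreover have "(1 - d) * r * S (D j \<union> A j) L - M \<le> real (\<Sum>K\<in>?X. \<Sum>J\<in>?Y K. s K J)"
    proof -
      have "(\<Sum>K\<in>?X. \<Sum>J\<in>?Y K. (1::real)) = real (card (SIGMA K:?X. ?Y K))"
        by simp
      also have "\<dots> \<le> M" unfolding M_def by (intro of_nat_mono card_mono) auto
      finally have "(1 - d) * r * S (D j \<union> A j) L - M \<le> (1 - d) * r * S (D j \<union> A j) L - (\<Sum>K\<in>?X. \<Sum>J\<in>?Y K. (1::real))"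
        by simp
      also have "\<dots> = (\<Sum>K\<in>?X. \<Sum>J\<in>?Y K. (1 - d) * r * CC K J - 1)"
        unfolding S_def by (simp only: sum_subtractf sum_distrib_left)
      also have "\<dots> \<le> (\<Sum>K\<in>?X. \<Sum>J\<in>?Y K. real (s K J))"
        by (intro sum_mono s_ge)
      finally show ?thesis by simp
    qed
    moreover have "3 * real ?n + M \<le> (1 - d) * r * S (D j \<union> A j) L - r * (\<Sum>i\<in>L. R $ i)"
      using rS[rule_format, of L j] L by (simp add: algebra_simps)
    ultimately have "real (sum t L + 2 * ?n) \<le> real (\<Sum>K\<in>?X. \<Sum>J\<in>?Y K. s K J)" by simp
    then show "sum t L + 2 * ?n \<le> (\<Sum>K\<in>?X. \<Sum>J\<in>?Y K. s K J)" by linarith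
  qed
  then obtain enc dec where code: "index_code A t u enc dec" by blast
  have "R $ j \<le> real (t j) / r" for j
    using r unfolding t_def by (simp add: pos_le_divide_eq mult.commute) linarith
  moreover have "real (u J) / r \<le> C J" if "J \<in> servers" for J
    using r capacities[OF that] unfolding u_def by (simp add: pos_divide_le_eq mult.commute of_nat_floor)
  ultimately have "achievable A R C" unfolding achievable_def using code r by blast
  then show ?thesis
    unfolding capacity_region_def using rates by (intro closure_subset[THEN subsetD]) auto
qed

end
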